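(* Let $\lambda\in\mathbf{k}$ and let $(\mathfrak{M};\rho,\mathrm{d}_{\mathfrak{M}})$ be a representation of a modified $\lambda$-differential 3-Lie algebra $(\mathfrak{A},[-,-,-],\mathrm{d})$. The linear map $\partial:\mathcal{C}^n_{\mathrm{md3Lie}_\lambda}(\mathfrak{A},\mathfrak{M})\to\mathcal{C}^{n+1}_{\mathrm{md3Lie}_\lambda}(\mathfrak{A},\mathfrak{M})$, $n\ge 1$, defined by $\partial(f)=(\delta f,-\Phi f)$ for $f\in\mathcal{C}^1_{\mathrm{md3Lie}_\lambda}(\mathfrak{A},\mathfrak{M})$ and $\partial(f,g)=(\delta f,\ \delta g+(-1)^n\Phi f)$ for $(f,g)\in\mathcal{C}^n_{\mathrm{md3Lie}_\lambda}(\mathfrak{A},\mathfrak{M})$, $n\ge 2$, is a coboundary operator, that is, $\partial\circ\partial=0$.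
   Context: Throughout, $\mathbf{k}$ is a field of characteristic zero; all vector spaces and linear maps are over $\mathbf{k}$. 3-Lie algebra: a vector space $\mathfrak{A}$ with a skew-symmetric trilinear bracket $[-,-,-]:\wedge^3\mathfrak{A}\to\mathfrak{A}$ satisfying $[a_1,a_2,[a_3,a_4,a_5]]=[[a_1,a_2,a_3],a_4,a_5]+[a_3,[a_1,a_2,a_4],a_5]+[a_3,a_4,[a_1,a_2,a_5]]$. Modified $\lambda$-differential 3-Lie algebra: a triple $(\mathfrak{A},[-,-,-],\mathrm{d})$ with $(\mathfrak{A},[-,-,-])$ a 3-Lie algebra and $\mathrm{d}:\mathfrak{A}\to\mathfrak{A}$ linear such that $\mathrm{d}[a_1,a_2,a_3]=[\mathrm{d}(a_1),a_2,a_3]+[a_1,\mathrm{d}(a_2),a_3]+[a_1,a_2,\mathrm{d}(a_3)]+\lambda[a_1,a_2,a_3]$. Representation of $(\mathfrak{A},[-,-,-],\mathrm{d})$: a triple $(\mathfrak{M};\rho,\mathrm{d}_{\mathfrak{M}})$ with $\mathfrak{M}$ a vector space, $\rho:\mathfrak{A}\wedge\mathfrak{A}\to\mathrm{End}(\mathfrak{M})$ skew-symmetric bilinear, $\mathrm{d}_{\mathfrak{M}}\in\mathrm{End}(\mathfrak{M})$, such that $\rho([a_1,a_2,a_3],a_4)=\rho(a_2,a_3)\rho(a_1,a_4)+\rho(a_3,a_1)\rho(a_2,a_4)+\rho(a_1,a_2)\rho(a_3,a_4)$, $\rho(a_1,a_2)\rho(a_3,a_4)=\rho(a_3,a_4)\rho(a_1,a_2)+\rho([a_1,a_2,a_3],a_4)+\rho(a_3,[a_1,a_2,a_4])$,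 $\mathrm{d}_{\mathfrak{M}}(\rho(a,b)v)=\rho(\mathrm{d}(a),b)v+\rho(a,\mathrm{d}(b))v+\rho(a,b)\mathrm{d}_{\mathfrak{M}}(v)+\lambda\rho(a,b)v$. Cochains: for $n\ge1$, $\mathcal{C}^n_{\mathrm{3Lie}}(\mathfrak{A},\mathfrak{M})=\mathrm{Hom}((\wedge^2\mathfrak{A})^{\otimes n-1}\wedge\mathfrak{A},\mathfrak{M})$, meaning linear maps $f(A_1,\dots,A_{n-1},a_n)$ with $A_i=a_i\wedge b_i\in\wedge^2\mathfrak{A}$, $a_n\in\mathfrak{A}$, that (for $n\ge 2$) are skew-symmetric in the last three arguments $a_{n-1},b_{n-1},a_n$; so $\mathcal{C}^1_{\mathrm{3Lie}}=\mathrm{Hom}(\mathfrak{A},\mathfrak{M})$ and $\mathcal{C}^2_{\mathrm{3Lie}}=\mathrm{Hom}(\wedge^3\mathfrak{A},\mathfrak{M})$. The coboundary $\delta:\mathcal{C}^n_{\mathrm{3Lie}}(\mathfrak{A},\mathfrak{M})\to\mathcal{C}^{n+1}_{\mathrm{3Lie}}(\mathfrak{A},\mathfrak{M})$ is $$\begin{aligned}\delta f(A_1,\dots,A_n,a_{n+1})=&(-1)^{n+1}\big(\rho(b_n,a_{n+1})f(A_1,\dots,A_{n-1},a_n)+\rho(a_{n+1},a_n)f(A_1,\dots,A_{n-1},b_n)\big)\\&+\sum_{i=1}^n(-1)^{i+1}\rho(a_i,b_i)f(A_1,\dots,A_{i-1},A_{i+1},\dots,A_n,a_{n+1})\\&+\sum_{i=1}^n(-1)^if(A_1,\dots,A_{i-1},A_{i+1},\dots,A_n,[a_i,b_i,a_{n+1}])\\&+\sum_{1\le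 i<k\le n}(-1)^if(A_1,\dots,A_{i-1},A_{i+1},\dots,A_{k-1},[a_i,b_i,a_k]\wedge b_k+a_k\wedge[a_i,b_i,b_k],\dots,A_n,a_{n+1}).\end{aligned}$$ It is a known fact that $\delta\circ\delta=0$. The map $\Phi:\mathcal{C}^n_{\mathrm{3Lie}}(\mathfrak{A},\mathfrak{M})\to\mathcal{C}^n_{\mathrm{3Lie}}(\mathfrak{A},\mathfrak{M})$ is $$\begin{aligned}\Phi f(A_1,\dots,A_{n-1},a_n)=&\sum_{i=1}^{n-1}f(A_1,\dots,A_{i-1},\mathrm{d}(a_i)\wedge b_i+a_i\wedge\mathrm{d}(b_i),A_{i+1},\dots,A_{n-1},a_n)+f(A_1,\dots,A_{n-1},\mathrm{d}(a_n))\\&+(n-1)\lambda f(A_1,\dots,A_{n-1},a_n)-\mathrm{d}_{\mathfrak{M}}(f(A_1,\dots,A_{n-1},a_n)).\end{aligned}$$ Finally $\mathcal{C}^1_{\mathrm{md3Lie}_\lambda}(\mathfrak{A},\mathfrak{M})=\mathrm{Hom}(\mathfrak{A},\mathfrak{M})$ and $\mathcal{C}^n_{\mathrm{md3Lie}_\lambda}(\mathfrak{A},\mathfrak{M})=\mathcal{C}^n_{\mathrm{3Lie}}(\mathfrak{A},\mathfrak{M})\oplus\mathcal{C}^{n-1}_{\mathrm{3Lie}}(\mathfrak{A},\mathfrak{M})$ for $n\ge2$. *)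

theory Defs
  imports Complex_Main "HOL-Library.Function_Algebras" "HOL-Library.Product_Plus"
begin

locale three_lie_algebra = vector_space scale
  for scale :: "'k::field_char_0 \<Rightarrow> 'a::ab_group_add \<Rightarrow> 'a" +
  fixes bracket :: "'a \<Rightarrow> 'a \<Rightarrow> 'a \<Rightarrow> 'a"
  assumes bracket_linear1: "Vector_Spaces.linear scale scale (\<lambda>a. bracket a b c)"
    and bracket_linear2: "Vector_Spaces.linear scale scale (\<lambda>b. bracket a b c)"
    and bracket_linear3: "Vector_Spaces.linear scale scale (\<lambda>c. bracket a b c)"
    and bracket_skew12: "bracket b a c = - bracket a b c"
    and bracket_skew23: "bracket a c b = - bracket a b c"
    and fundamental_identity:
      "bracket a1 a2 (bracket a3 a4 a5) =
         bracket (bracket a1 a2 a3) a4 a5 + bracket a3 (bracket a1 a2 a4) a5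
           + bracket a3 a4 (bracket a1 a2 a5)"

locale modified_differential_three_lie_algebra = three_lie_algebra scale bracket
  for scale :: "'k::field_char_0 \<Rightarrow> 'a::ab_group_add \<Rightarrow> 'a"
    and bracket :: "'a \<Rightarrow> 'a \<Rightarrow> 'a \<Rightarrow> 'a" +
  fixes d :: "'a \<Rightarrow> 'a" and lam :: 'k
  assumes d_linear: "Vector_Spaces.linear scale scale d"
    and d_bracket:
      "d (bracket a1 a2 a3) =
         bracket (d a1) a2 a3 + bracket a1 (d a2) a3 + bracket a1 a2 (d a3)
           + scale lam (bracket a1 a2 a3)"

locale md_representation =
  modified_differential_three_lie_algebra scaleA bracket d lam + M: vector_space scaleM
  for scaleA :: "'k::field_char_0 \<Rightarrow> 'a::ab_group_add \<Rightarrow> 'a"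
    and bracket :: "'a \<Rightarrow> 'a \<Rightarrow> 'a \<Rightarrow> 'a"
    and d :: "'a \<Rightarrow> 'a" and lam :: 'k
    and scaleM :: "'k \<Rightarrow> 'm::ab_group_add \<Rightarrow> 'm" +
  fixes rho :: "'a \<Rightarrow> 'a \<Rightarrow> 'm \<Rightarrow> 'm" and dM :: "'m \<Rightarrow> 'm"
  assumes rho_endo: "Vector_Spaces.linear scaleM scaleM (rho a b)"
    and rho_linear1: "Vector_Spaces.linear scaleA scaleM (\<lambda>a. rho a b v)"
    and rho_linear2: "Vector_Spaces.linear scaleA scaleM (\<lambda>b. rho a b v)"
    and rho_skew: "rho b a v = - rho a b v"
    and dM_linear: "Vector_Spaces.linear scaleM scaleM dM"
    and rho_bracket:
      "rho (bracket a1 a2 a3) a4 v =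
         rho a2 a3 (rho a1 a4 v) + rho a3 a1 (rho a2 a4 v) + rho a1 a2 (rho a3 a4 v)"
    and rho_commute:
      "rho a1 a2 (rho a3 a4 v) =
         rho a3 a4 (rho a1 a2 v) + rho (bracket a1 a2 a3) a4 v + rho a3 (bracket a1 a2 a4) v"
    and dM_rho:
      "dM (rho a b v) = rho (d a) b v + rho a (d b) v + rho a b (dM v) + scaleM lam (rho a b v)"

text \<open>
  A cochain of degree \<open>n\<close> is represented by its values on decomposable elements:
  \<open>f [(a\<^sub>1, b\<^sub>1), \<dots>, (a\<^sub>m, b\<^sub>m)] c\<close> with \<open>m = n - 1\<close> stands for
  \<open>f (a\<^sub>1 \<and> b\<^sub>1, \<dots>, a\<^sub>m \<and> b\<^sub>m, c)\<close>.
  By the universal properties of the tensor and exterior products, linear maps on the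
  tensor product of the exterior squares with the algebra are exactly the maps that are
  linear in every single vector and skew-symmetric in each pair \<open>(a\<^sub>i, b\<^sub>i)\<close>.
  Functions vanish on lists of the wrong length, so that equality of cochains of degree
  \<open>n\<close> is equality of functions.
\<close>

type_synonym ('a, 'm) cochain = "('a \<times> 'a) list \<Rightarrow> 'a \<Rightarrow> 'm"

definition cochains ::
  "('k::field_char_0 \<Rightarrow> 'a::ab_group_add \<Rightarrow> 'a) \<Rightarrow> ('k \<Rightarrow> 'm::ab_group_add \<Rightarrow> 'm)
    \<Rightarrow> nat \<Rightarrow> ('a, 'm) cochain set" where
  "cochains scaleA scaleM n = {f.
     (\<forall>As c. length As + 1 \<noteq> n \<longrightarrow> f As c = 0) \<and>
     (\<forall>As. length As + 1 = n \<longrightarrow> Vector_Spaces.linear scaleA scaleM (f As)) \<and>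
     (\<forall>As Bs a b c. length As + length Bs + 2 = n \<longrightarrow>
        Vector_Spaces.linear scaleA scaleM (\<lambda>x. f (As @ (x, b) # Bs) c) \<and>
        Vector_Spaces.linear scaleA scaleM (\<lambda>x. f (As @ (a, x) # Bs) c) \<and>
        f (As @ (b, a) # Bs) c = - f (As @ (a, b) # Bs) c) \<and>
     (\<forall>As a b c. length As + 2 = n \<longrightarrow> f (As @ [(a, c)]) b = - f (As @ [(a, b)]) c)}"

text \<open>
  In the following operators, list positions are counted from \<open>1\<close>, and the degree is read
  off from the length of the list of pairs. The value of a cochain at a sum
  \<open>x \<and> b + a \<and> y\<close> is the sum of its values at the two decomposable elements.
\<close>

definition omit :: "nat \<Rightarrow> 'b list \<Rightarrow> 'b list" where
  "omit i xs = take (i - 1) xs @ drop i xs"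

text \<open>The value at the empty list only makes \<open>delta f\<close> vanish outside of degrees \<open>\<ge> 2\<close>.\<close>

definition delta ::
  "('a \<Rightarrow> 'a \<Rightarrow> 'a \<Rightarrow> 'a) \<Rightarrow> ('k::field_char_0 \<Rightarrow> 'm::ab_group_add \<Rightarrow> 'm)
    \<Rightarrow> ('a \<Rightarrow> 'a \<Rightarrow> 'm \<Rightarrow> 'm) \<Rightarrow> ('a, 'm) cochain \<Rightarrow> ('a, 'm) cochain" where
  "delta bracket scaleM rho f As c =
     (if As = [] then 0 else
      let n = length As; a = (\<lambda>i. fst (As ! (i - 1))); b = (\<lambda>i. snd (As ! (i - 1))) in
        scaleM ((-1) ^ (n + 1))
          (rho (b n) c (f (butlast As) (a n)) + rho c (a n) (f (butlast As) (b n)))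
      + (\<Sum>i=1..n. scaleM ((-1) ^ (i + 1)) (rho (a i) (b i) (f (omit i As) c)))
      + (\<Sum>i=1..n. scaleM ((-1) ^ i) (f (omit i As) (bracket (a i) (b i) c)))
      + (\<Sum>i=1..n. \<Sum>k=i+1..n. scaleM ((-1) ^ i)
           (f (omit i (As[k - 1 := (bracket (a i) (b i) (a k), b k)])) c
          + f (omit i (As[k - 1 := (a k, bracket (a i) (b i) (b k))])) c)))"

definition Phi ::
  "('a \<Rightarrow> 'a) \<Rightarrow> 'k::field_char_0 \<Rightarrow> ('k \<Rightarrow> 'm::ab_group_add \<Rightarrow> 'm) \<Rightarrow> ('m \<Rightarrow> 'm)
    \<Rightarrow> ('a, 'm) cochain \<Rightarrow> ('a, 'm) cochain" where
  "Phi d lam scaleM dM f As c =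
     (let m = length As; a = (\<lambda>i. fst (As ! (i - 1))); b = (\<lambda>i. snd (As ! (i - 1))) in
        (\<Sum>i=1..m. f (As[i - 1 := (d (a i), b i)]) c + f (As[i - 1 := (a i, d (b i))]) c)
      + f As (d c)
      + scaleM (of_nat m * lam) (f As c)
      - dM (f As c))"

definition cochain_scale ::
  "('k \<Rightarrow> 'm \<Rightarrow> 'm) \<Rightarrow> 'k \<Rightarrow> ('a, 'm) cochain \<Rightarrow> ('a, 'm) cochain" where
  "cochain_scale scaleM r f = (\<lambda>As c. scaleM r (f As c))"

definition md_cochain_scale ::
  "('k \<Rightarrow> 'm \<Rightarrow> 'm) \<Rightarrow> 'k \<Rightarrow> ('a, 'm) cochain \<times> ('a, 'm) cochain
    \<Rightarrow> ('a, 'm) cochain \<times> ('a, 'm) cochain" where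
  "md_cochain_scale scaleM r = map_prod (cochain_scale scaleM r) (cochain_scale scaleM r)"

text \<open>
  In degree \<open>1\<close> the cochains of the modified differential algebra are single maps,
  that is, \<open>cochains scaleA scaleM 1\<close>; in degrees \<open>n \<ge> 2\<close> they are the pairs below.
  Accordingly, the coboundary operator is given by two functions.
\<close>

definition md_cochains ::
  "('k::field_char_0 \<Rightarrow> 'a::ab_group_add \<Rightarrow> 'a) \<Rightarrow> ('k \<Rightarrow> 'm::ab_group_add \<Rightarrow> 'm)
    \<Rightarrow> nat \<Rightarrow> (('a, 'm) cochain \<times> ('a, 'm) cochain) set" where
  "md_cochains scaleA scaleM n = cochains scaleA scaleM n \<times> cochains scaleA scaleM (n - 1)"

definition md_coboundary1 ::
  "('a \<Rightarrow> 'a \<Rightarrow> 'a \<Rightarrow> 'a) \<Rightarrow> ('a \<Rightarrow> 'a) \<Rightarrow> 'k::field_char_0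
    \<Rightarrow> ('k \<Rightarrow> 'm::ab_group_add \<Rightarrow> 'm) \<Rightarrow> ('a \<Rightarrow> 'a \<Rightarrow> 'm \<Rightarrow> 'm) \<Rightarrow> ('m \<Rightarrow> 'm)
    \<Rightarrow> ('a, 'm) cochain \<Rightarrow> ('a, 'm) cochain \<times> ('a, 'm) cochain" where
  "md_coboundary1 bracket d lam scaleM rho dM f =
     (delta bracket scaleM rho f, - Phi d lam scaleM dM f)"

definition md_coboundary ::
  "('a \<Rightarrow> 'a \<Rightarrow> 'a \<Rightarrow> 'a) \<Rightarrow> ('a \<Rightarrow> 'a) \<Rightarrow> 'k::field_char_0
    \<Rightarrow> ('k \<Rightarrow> 'm::ab_group_add \<Rightarrow> 'm) \<Rightarrow> ('a \<Rightarrow> 'a \<Rightarrow> 'm \<Rightarrow> 'm) \<Rightarrow> ('m \<Rightarrow> 'm) \<Rightarrow> nat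
    \<Rightarrow> ('a, 'm) cochain \<times> ('a, 'm) cochain \<Rightarrow> ('a, 'm) cochain \<times> ('a, 'm) cochain" where
  "md_coboundary bracket d lam scaleM rho dM n = (\<lambda>(f, g).
     (delta bracket scaleM rho f,
      delta bracket scaleM rho g + cochain_scale scaleM ((-1) ^ n) (Phi d lam scaleM dM f)))"

definition linear_map_between ::
  "('k \<Rightarrow> 'v::ab_group_add \<Rightarrow> 'v) \<Rightarrow> ('k \<Rightarrow> 'w::ab_group_add \<Rightarrow> 'w)
    \<Rightarrow> 'v set \<Rightarrow> 'w set \<Rightarrow> ('v \<Rightarrow> 'w) \<Rightarrow> bool" where
  "linear_map_between s1 s2 V W T \<longleftrightarrow>
     (\<forall>x\<in>V. T x \<in> W) \<and>
     (\<forall>x\<in>V. \<forall>y\<in>V. T (x + y) = T x + T y) \<and>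
     (\<forall>r. \<forall>x\<in>V. T (s1 r x) = s2 r (T x))"

end

theory Submission
  imports Defs
begin

text \<open>
  Cartan calculus. For \<open>A = a \<and> b\<close> let \<open>\<iota>\<^sub>A f\<close> be \<open>f\<close> with \<open>A\<close> inserted as first argument, and let
  \<open>L\<^sub>A f\<close> be \<open>\<rho>(a,b) \<circ> f\<close> minus the extension of the derivation \<open>[a,b,-]\<close> to the arguments of \<open>f\<close>. Then
  \<open>\<iota>\<^sub>A \<delta> = L\<^sub>A + R\<^sub>A - \<delta> \<iota>\<^sub>A\<close>, where the correction \<open>R\<^sub>A\<close> only lives in degree one and
  \<open>\<delta> R\<^sub>A = 0\<close>. From \<open>[L\<^sub>A, L\<^sub>B] = L\<^bsub>A\<cdot>B\<^esub>\<close> one gets \<open>[L\<^sub>A, \<delta>] = 0\<close> and then \<open>\<delta>\<delta> = 0\<close>, each by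
  induction on the number of arguments. In the same way
  \<open>\<iota>\<^sub>A \<Phi> = \<Phi> \<iota>\<^sub>A + \<iota>\<^bsub>dA\<^esub> + \<lambda> \<iota>\<^sub>A\<close> and \<open>[L\<^sub>A, \<Phi>] = L\<^bsub>dA\<^esub> + \<lambda> L\<^sub>A\<close> give \<open>\<Phi>\<delta> = \<delta>\<Phi>\<close>, and the
  two commutation relations make the mapping-cone differential square to zero.
\<close>

subsection \<open>Derivation extensions\<close>

text \<open>The Leibniz action of \<open>D\<close> on all arguments, peeled off pair by pair so that
  identities follow by induction on the list of pairs.\<close>

fun der :: "('a \<Rightarrow> 'a) \<Rightarrow> ('a, 'm::ab_group_add) cochain \<Rightarrow> ('a, 'm) cochain" where
  "der D f [] c = f [] (D c)"
| "der D f ((a, b) # As) c =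
     der D (\<lambda>Xs. f ((a, b) # Xs)) As c + f ((D a, b) # As) c + f ((a, D b) # As) c"

lemma der_Cons_abs:
  "(\<lambda>Xs. der D f ((a, b) # Xs)) =
     (\<lambda>Xs c. der D (\<lambda>Ys. f ((a, b) # Ys)) Xs c + f ((D a, b) # Xs) c + f ((a, D b) # Xs) c)"
  by (intro ext) simp

text \<open>Bridge between the recursion and the positional sums that occur in \<open>Phi\<close>
  and \<open>delta\<close>.\<close>

lemma der_conv_sum:
  "der D f As c =
     (\<Sum>i=1..length As. f (As[i - 1 := (D (fst (As ! (i - 1))), snd (As ! (i - 1)))]) c
                     + f (As[i - 1 := (fst (As ! (i - 1)), D (snd (As ! (i - 1))))]) c)
     + f As (D c)"
proof (induction As arbitrary: f)
  case Nil
  show ?case by simp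
next
  case (Cons A As)
  show ?case
    by (cases A) (simp add: sum.atLeast1_atMost_eq sum.lessThan_Suc_shift Cons.IH
        algebra_simps del: sum.lessThan_Suc sum.cl_ivl_Suc)
qed

lemma der_plus: "der D (\<lambda>Xs x. f Xs x + g Xs x) As c = der D f As c + der D g As c"
  by (induction As arbitrary: f g rule: list.induct) (auto simp: split_paired_all)

text \<open>\<open>der\<close> never changes the number of pairs, so an additive outer map that
  depends on this number still passes through. This covers the degree-dependent factor of \<lambda>
  in \<open>Phi\<close>.\<close>

lemma der_map_length:
  assumes "\<And>n x y. h n (x + y) = h n x + h n y"
  shows "der D (\<lambda>Xs x. h (length Xs) (f Xs x)) As c = h (length As) (der D f As c)"
  using assms
proof (induction As arbitrary: f h rule: list.induct)
  case Nil
  show ?case by simp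
next
  case (Cons A As)
  then show ?case
    using Cons.IH[of "\<lambda>n. h (Suc n)"] by (cases A) simp
qed

lemma der_map:
  assumes "\<And>x y. h (x + y) = h x + h y"
  shows "der D (\<lambda>Xs x. h (f Xs x)) As c = h (der D f As c)"
  using der_map_length[of "\<lambda>_. h"] assms by simp

lemma der_uminus: "der D (\<lambda>Xs x. - f Xs x) As c = - der D f As c"
  by (rule der_map) simp

lemma der_minus: "der D (\<lambda>Xs x. f Xs x - g Xs x) As c = der D f As c - der D g As c"
  using der_plus[of D f "\<lambda>Xs x. - g Xs x"] by (simp add: der_uminus)

text \<open>Terms with \<open>D\<close> and \<open>E\<close> at two different vectors cancel; what
  survives is both acting on the same vector. The order of composition is reversed because
  \<open>der\<close> acts by precomposition.\<close>

lemma der_commutator: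
  "der D (der E f) As c - der E (der D f) As c
     = der (\<lambda>x. E (D x)) f As c - der (\<lambda>x. D (E x)) f As c"
proof (induction As arbitrary: f rule: list.induct)
  case Nil
  show ?case by simp
next
  case (Cons A As)
  obtain a b where A: "A = (a, b)" by (cases A)
  show ?case
    using Cons.IH[of "\<lambda>Xs. f ((a, b) # Xs)"]
    by (simp add: A der_Cons_abs der_plus algebra_simps)
qed

lemma der_vanish:
  assumes "\<And>Xs x. length Xs = length As \<Longrightarrow> f Xs x = 0"
  shows "der D f As c = 0"
  using assms by (induction As arbitrary: f) auto

subsection \<open>Cartan calculus\<close>

context md_representation
begin

abbreviation "linAM \<equiv> Vector_Spaces.linear scaleA scaleM"
abbreviation "\<delta> \<equiv> delta bracket scaleM rho"
abbreviation "\<Phi> \<equiv> Phi d lam scaleM dM"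

definition lie :: "'a \<Rightarrow> 'a \<Rightarrow> ('a, 'm) cochain \<Rightarrow> ('a, 'm) cochain" where
  "lie a b f As c = rho a b (f As c) - der (bracket a b) f As c"

text \<open>The correction term \<open>R\<^sub>A\<close> in \<open>\<iota>\<^sub>A \<delta> = L\<^sub>A + R\<^sub>A - \<delta> \<iota>\<^sub>A\<close>.\<close>

definition corr :: "'a \<Rightarrow> 'a \<Rightarrow> ('a, 'm) cochain \<Rightarrow> ('a, 'm) cochain" where
  "corr a b f As c = (if As = [] then rho b c (f [] a) + rho c a (f [] b) else 0)"

section \<open>Linearity of the bracket, of \<open>rho\<close> and of \<open>dM\<close>\<close>

lemma linAM_iff: "linAM h \<longleftrightarrow> (\<forall>x y. h (x + y) = h x + h y) \<and> (\<forall>r x. h (scaleA r x) = scaleM r (h x))"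
  by (simp add: Vector_Spaces.linear_iff vector_space_axioms M.vector_space_axioms)

lemma bracket_add:
  "bracket (x + y) b c = bracket x b c + bracket y b c"
  "bracket a (x + y) c = bracket a x c + bracket a y c"
  "bracket a b (x + y) = bracket a b x + bracket a b y"
  using bracket_linear1 bracket_linear2 bracket_linear3 by (auto simp: Vector_Spaces.linear_iff)

lemma bracket_scale:
  "bracket (scaleA r x) b c = scaleA r (bracket x b c)"
  "bracket a (scaleA r x) c = scaleA r (bracket a x c)"
  "bracket a b (scaleA r x) = scaleA r (bracket a b x)"
  using bracket_linear1 bracket_linear2 bracket_linear3 by (auto simp: Vector_Spaces.linear_iff)

lemma dM_add: "dM (x + y) = dM x + dM y"
  and dM_scale: "dM (scaleM r x) = scaleM r (dM x)"
  using dM_linear by (auto simp: Vector_Spaces.linear_iff)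

lemma dM_zero: "dM 0 = 0"
  using dM_add[of 0 0] by simp

lemma dM_minus: "dM (- x) = - dM x"
  using dM_add[of x "- x"] by (simp add: dM_zero add_eq_0_iff)

lemma dM_diff: "dM (x - y) = dM x - dM y"
  using dM_add[of x "- y"] by (simp add: dM_minus)

lemma rho_add:
  "rho (x + y) b v = rho x b v + rho y b v"
  "rho a (x + y) v = rho a x v + rho a y v"
  "rho a b (v + w) = rho a b v + rho a b w"
  using rho_linear1 rho_linear2 rho_endo by (auto simp: Vector_Spaces.linear_iff)

lemma rho_scale:
  "rho (scaleA r x) b v = scaleM r (rho x b v)"
  "rho a (scaleA r x) v = scaleM r (rho a x v)"
  "rho a b (scaleM r v) = scaleM r (rho a b v)"
  using rho_linear1 rho_linear2 rho_endo by (auto simp: Vector_Spaces.linear_iff)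

lemma rho_zero: "rho a b 0 = 0"
  using rho_add(3)[of a b 0 0] by simp

lemma rho_minus: "rho a b (- v) = - rho a b v"
  using rho_add(3)[of a b v "- v"] by (simp add: rho_zero add_eq_0_iff)

lemma rho_diff: "rho a b (v - w) = rho a b v - rho a b w"
  using rho_add(3)[of a b v "- w"] by (simp add: rho_minus)

lemma linAM_plus: "linAM g \<Longrightarrow> linAM h \<Longrightarrow> linAM (\<lambda>x. g x + h x)"
  by (simp add: linAM_iff M.scale_right_distrib algebra_simps)

lemma linAM_diff: "linAM g \<Longrightarrow> linAM h \<Longrightarrow> linAM (\<lambda>x. g x - h x)"
  by (simp add: linAM_iff M.scale_right_diff_distrib algebra_simps)

lemma linAM_zero: "linAM (\<lambda>x. 0)"
  by (simp add: linAM_iff)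

lemma linAM_scale: "linAM h \<Longrightarrow> linAM (\<lambda>x. scaleM r (h x))"
  by (simp add: linAM_iff M.scale_right_distrib M.scale_left_commute)

lemma linAM_rho: "linAM h \<Longrightarrow> linAM (\<lambda>x. rho a b (h x))"
  by (simp add: linAM_iff rho_add rho_scale)

lemma linAM_dM: "linAM h \<Longrightarrow> linAM (\<lambda>x. dM (h x))"
  by (simp add: linAM_iff dM_add dM_scale)

text \<open>Linearity in each slot is demanded for lists of every length. Being free of the degree,
  the condition survives the insertion of a first pair, which is what the inductions
  require.\<close>

definition multilinear :: "('a, 'm) cochain \<Rightarrow> bool" where
  "multilinear f \<longleftrightarrow> (\<forall>As. linAM (f As)) \<and>
     (\<forall>As Bs a b c. linAM (\<lambda>x. f (As @ (x, b) # Bs) c) \<and> linAM (\<lambda>x. f (As @ (a, x) # Bs) c))"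

lemma multilinear_Cons:
  assumes "multilinear f" shows "multilinear (\<lambda>Xs. f (A # Xs))"
  unfolding multilinear_def
proof (intro conjI allI)
  show "linAM (f (A # As))" for As
    using assms by (simp add: multilinear_def)
  fix As Bs a b c
  have "linAM (\<lambda>x. f ((A # As) @ (x, b) # Bs) c)" "linAM (\<lambda>x. f ((A # As) @ (a, x) # Bs) c)"
    using assms unfolding multilinear_def by blast+
  then show "linAM (\<lambda>x. f (A # As @ (x, b) # Bs) c)" "linAM (\<lambda>x. f (A # As @ (a, x) # Bs) c)"
    by simp_all
qed

lemma multilinear_linAM:
  assumes "multilinear f"
  shows "linAM (f As)" "linAM (\<lambda>x. f ((x, b) # As) c)" "linAM (\<lambda>x. f ((a, x) # As) c)"
proof -
  have "linAM (\<lambda>x. f ([] @ (x, b) # As) c)" "linAM (\<lambda>x. f ([] @ (a, x) # As) c)"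
    using assms unfolding multilinear_def by blast+
  then show "linAM (\<lambda>x. f ((x, b) # As) c)" "linAM (\<lambda>x. f ((a, x) # As) c)"
    by simp_all
  show "linAM (f As)"
    using assms unfolding multilinear_def by blast
qed

lemma multilinear_add:
  assumes "multilinear f"
  shows "f As (x + y) = f As x + f As y"
    "f ((x + y, b) # As) c = f ((x, b) # As) c + f ((y, b) # As) c"
    "f ((a, x + y) # As) c = f ((a, x) # As) c + f ((a, y) # As) c"
  using multilinear_linAM[OF assms] unfolding linAM_iff by blast+

lemma multilinear_scale:
  assumes "multilinear f"
  shows "f As (scaleA r x) = scaleM r (f As x)"
    "f ((scaleA r x, b) # As) c = scaleM r (f ((x, b) # As) c)"
    "f ((a, scaleA r x) # As) c = scaleM r (f ((a, x) # As) c)"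
  using multilinear_linAM[OF assms] unfolding linAM_iff by blast+

section \<open>Derivations and Lie derivatives on multilinear cochains\<close>

lemma der_add:
  assumes "multilinear f"
  shows "der (\<lambda>x. D x + E x) f As c = der D f As c + der E f As c"
  using assms
proof (induction As arbitrary: f rule: list.induct)
  case Nil
  then show ?case by (simp add: multilinear_add)
next
  case (Cons A As)
  obtain a b where A: "A = (a, b)" by (cases A)
  show ?case
    using Cons.IH[OF multilinear_Cons[OF Cons.prems, of A]]
    by (simp add: A multilinear_add[OF Cons.prems] algebra_simps)
qed

lemma der_scale:
  assumes "multilinear f"
  shows "der (\<lambda>x. scaleA r (D x)) f As c = scaleM r (der D f As c)"
  using assms
proof (induction As arbitrary: f rule: list.induct)
  case Nil
  then show ?case by (simp add: multilinear_scale)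
next
  case (Cons A As)
  obtain a b where A: "A = (a, b)" by (cases A)
  show ?case
    using Cons.IH[OF multilinear_Cons[OF Cons.prems, of A]]
    by (simp add: A multilinear_scale[OF Cons.prems] M.scale_right_distrib)
qed

text \<open>The fundamental identity expresses \<open>[a,b,-]\<close> after \<open>[x,y,-]\<close>
  through three maps; \<open>der\<close> is additive in its map on multilinear cochains, and
  \<open>der_commutator\<close> turns the two composites into a commutator.\<close>

lemma der_bracket:
  assumes "multilinear f"
  shows "der (bracket (bracket a b x) y) f As c + der (bracket x (bracket a b y)) f As c
     = der (bracket x y) (der (bracket a b) f) As c - der (bracket a b) (der (bracket x y) f) As c"
proof -
  have "der (\<lambda>z. bracket a b (bracket x y z)) f As c =
      der (bracket (bracket a b x) y) f As c + der (bracket x (bracket a b y)) f As c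
        + der (\<lambda>z. bracket x y (bracket a b z)) f As c"
    unfolding fundamental_identity[of a b x y] by (simp only: der_add[OF assms])
  then show ?thesis
    by (simp add: der_commutator)
qed

lemma lie_add: "lie a b (\<lambda>Xs x. f Xs x + g Xs x) As c = lie a b f As c + lie a b g As c"
  by (simp add: lie_def der_plus rho_add)

lemma lie_uminus: "lie a b (\<lambda>Xs x. - f Xs x) As c = - lie a b f As c"
  by (simp add: lie_def der_uminus rho_minus)

lemma lie_diff: "lie a b (\<lambda>Xs x. f Xs x - g Xs x) As c = lie a b f As c - lie a b g As c"
  using lie_add[of a b f "\<lambda>Xs x. - g Xs x"] by (simp add: lie_uminus)

lemma lie_scale: "lie a b (\<lambda>Xs x. scaleM r (f Xs x)) As c = scaleM r (lie a b f As c)"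
  by (simp add: lie_def der_map[of "scaleM r"] M.scale_right_distrib rho_scale M.scale_right_diff_distrib)

lemma lie_abs: "lie a b f = (\<lambda>As c. rho a b (f As c) - der (bracket a b) f As c)"
  by (intro ext) (simp add: lie_def)

text \<open>The values contribute the second representation axiom and the arguments
  \<open>der_bracket\<close>; the mixed terms cancel since \<open>rho a b\<close> passes through
  \<open>der\<close>.\<close>

lemma lie_commutator:
  assumes "multilinear f"
  shows "lie a b (lie x y f) As c - lie x y (lie a b f) As c
     = lie (bracket a b x) y f As c + lie x (bracket a b y) f As c"
  using der_bracket[OF assms, of a b x y As c] rho_commute[of a b x y "f As c"]
  by (simp add: lie_abs der_minus der_map[of "rho _ _"] rho_add rho_diff algebra_simps)

lemma lie_Cons:
  "lie a b f ((x, y) # As) c =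
     lie a b (\<lambda>Xs. f ((x, y) # Xs)) As c
       - f ((bracket a b x, y) # As) c - f ((x, bracket a b y) # As) c"
  by (simp add: lie_def)

lemma lie_Cons_abs:
  "(\<lambda>As. lie a b f ((x, y) # As)) =
     (\<lambda>As c. lie a b (\<lambda>Xs. f ((x, y) # Xs)) As c
       - f ((bracket a b x, y) # As) c - f ((x, bracket a b y) # As) c)"
  by (intro ext) (rule lie_Cons)

section \<open>Recursive form of the coboundary\<close>

lemma delta_Nil: "\<delta> f [] c = 0"
  by (simp add: delta_def)

definition delta_pair_summand ::
  "('a, 'm) cochain \<Rightarrow> ('a \<times> 'a) list \<Rightarrow> 'a \<Rightarrow> nat \<Rightarrow> nat \<Rightarrow> 'm" where
  "delta_pair_summand f As c i k =
     (let a = (\<lambda>i. fst (As ! (i - 1))); b = (\<lambda>i. snd (As ! (i - 1))) in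
        scaleM ((-1) ^ i)
          (f (omit i (As[k - 1 := (bracket (a i) (b i) (a k), b k)])) c
         + f (omit i (As[k - 1 := (a k, bracket (a i) (b i) (b k))])) c))"

text \<open>All terms of the coboundary in which the pair at position \<open>i\<close> is removed.
  Only the term where the last pair is split up stays outside.\<close>

definition delta_summand :: "('a, 'm) cochain \<Rightarrow> ('a \<times> 'a) list \<Rightarrow> 'a \<Rightarrow> nat \<Rightarrow> 'm" where
  "delta_summand f As c i =
     (let a = (\<lambda>i. fst (As ! (i - 1))); b = (\<lambda>i. snd (As ! (i - 1))) in
        scaleM ((-1) ^ (i + 1)) (rho (a i) (b i) (f (omit i As) c))
      + scaleM ((-1) ^ i) (f (omit i As) (bracket (a i) (b i) c))
      + (\<Sum>k=i+1..length As. delta_pair_summand f As c i k))"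

lemma delta_conv_summand:
  assumes "As \<noteq> []"
  shows "\<delta> f As c =
     scaleM ((-1) ^ (length As + 1))
       (rho (snd (last As)) c (f (butlast As) (fst (last As)))
        + rho c (fst (last As)) (f (butlast As) (snd (last As))))
     + (\<Sum>i=1..length As. delta_summand f As c i)"
  unfolding delta_def delta_summand_def delta_pair_summand_def Let_def
    last_conv_nth[OF assms] sum.distrib
  using assms by (simp only: if_False add.assoc)

lemma omit_Suc_Cons: "i \<ge> 1 \<Longrightarrow> omit (Suc i) (x # xs) = x # omit i xs"
  by (cases i) (auto simp: omit_def)

lemma nth_Cons_Suc_minus: "i \<ge> 1 \<Longrightarrow> (x # xs) ! (Suc i - 1) = xs ! (i - 1)"
  and list_update_Cons_Suc_minus: "i \<ge> 1 \<Longrightarrow> (x # xs)[Suc i - 1 := y] = x # xs[i - 1 := y]"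
  by (cases i; simp)+

lemma delta_pair_summand_1:
  assumes "k \<ge> 1"
  shows "delta_pair_summand f ((a, b) # As) c 1 (Suc k) =
     - (f (As[k - 1 := (bracket a b (fst (As ! (k - 1))), snd (As ! (k - 1)))]) c
      + f (As[k - 1 := (fst (As ! (k - 1)), bracket a b (snd (As ! (k - 1))))]) c)"
  unfolding delta_pair_summand_def Let_def nth_Cons_Suc_minus[OF assms]
    list_update_Cons_Suc_minus[OF assms]
  by (simp add: omit_def M.scale_minus_left)

lemma delta_pair_summand_Suc:
  assumes "i \<ge> 1" "k \<ge> 1"
  shows "delta_pair_summand f (A # As) c (Suc i) (Suc k) =
     - delta_pair_summand (\<lambda>Xs. f (A # Xs)) As c i k"
  unfolding delta_pair_summand_def Let_def assms[THEN nth_Cons_Suc_minus]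
    list_update_Cons_Suc_minus[OF assms(2)] omit_Suc_Cons[OF assms(1)]
  by (simp add: M.scale_minus_left)

text \<open>With the first pair removed, the sum over \<open>k\<close> runs through all remaining
  pairs. Together with the term bracketing into \<open>c\<close> it makes up the whole of
  \<open>der (bracket a b)\<close>.\<close>

lemma delta_summand_1: "delta_summand f ((a, b) # As) c 1 = lie a b f As c"
proof -
  have "(\<Sum>k=1+1..length ((a, b) # As). delta_pair_summand f ((a, b) # As) c 1 k) =
      (\<Sum>k=1..length As. delta_pair_summand f ((a, b) # As) c 1 (Suc k))"
    by (simp add: sum.shift_bounds_cl_Suc_ivl del: sum.cl_ivl_Suc)
  \<comment> \<open>The subtracted value is the part of \<open>der\<close> acting on the last
    argument, which the sum over pairs does not contain.\<close>
  also have "\<dots> = - (der (bracket a b) f As c - f As (bracket a b c))"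
    unfolding der_conv_sum add_diff_cancel_right' sum_negf[symmetric]
    by (rule sum.cong[OF refl delta_pair_summand_1]) simp
  finally show ?thesis
    unfolding delta_summand_def Let_def
    by (simp add: lie_def omit_def M.scale_minus_left del: sum.cl_ivl_Suc)
qed

lemma delta_summand_Suc:
  assumes "i \<in> {1..length As}"
  shows "delta_summand f (A # As) c (Suc i) = - delta_summand (\<lambda>Xs. f (A # Xs)) As c i"
proof -
  have i: "i \<ge> 1"
    using assms by simp
  have "(\<Sum>k=Suc i+1..length (A # As). delta_pair_summand f (A # As) c (Suc i) k) =
      (\<Sum>k=i+1..length As. delta_pair_summand f (A # As) c (Suc i) (Suc k))"
    by (simp add: sum.shift_bounds_cl_Suc_ivl del: sum.cl_ivl_Suc)
  also have "\<dots> = - (\<Sum>k=i+1..length As. delta_pair_summand (\<lambda>Xs. f (A # Xs)) As c i k)"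
    unfolding sum_negf[symmetric]
    by (rule sum.cong[OF refl delta_pair_summand_Suc[OF i]]) simp
  finally show ?thesis
    unfolding delta_summand_def Let_def nth_Cons_Suc_minus[OF i] omit_Suc_Cons[OF i]
    by (simp add: M.scale_minus_left del: sum.cl_ivl_Suc)
qed

text \<open>The Cartan formula. The summand \<open>i = 1\<close> is the Lie derivative; shifting the
  other indices by one flips every sign and leaves the coboundary of the insertion. The term
  splitting the last pair flips in the same way, unless \<open>(a, b)\<close> is itself the last
  pair, and then it is \<open>corr\<close>.\<close>

lemma delta_Cons:
  "\<delta> f ((a, b) # As) c = lie a b f As c + corr a b f As c - \<delta> (\<lambda>Xs. f ((a, b) # Xs)) As c"
proof (cases "As = []")
  case True
  then show ?thesis
    by (simp add: delta_def lie_def corr_def omit_def)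
next
  case False
  have "(\<Sum>i=1..length ((a, b) # As). delta_summand f ((a, b) # As) c i) =
      lie a b f As c + (\<Sum>i=1..length As. delta_summand f ((a, b) # As) c (Suc i))"
    unfolding One_nat_def by (simp add: sum.atLeast_Suc_atMost sum.shift_bounds_cl_Suc_ivl
        delta_summand_1[simplified] del: sum.cl_ivl_Suc)
  also have "(\<Sum>i=1..length As. delta_summand f ((a, b) # As) c (Suc i)) =
      - (\<Sum>i=1..length As. delta_summand (\<lambda>Xs. f ((a, b) # Xs)) As c i)"
    unfolding sum_negf[symmetric] by (rule sum.cong[OF refl delta_summand_Suc])
  finally have "(\<Sum>i=1..length ((a, b) # As). delta_summand f ((a, b) # As) c i) =
      lie a b f As c - (\<Sum>i=1..length As. delta_summand (\<lambda>Xs. f ((a, b) # Xs)) As c i)"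
    by simp
  then show ?thesis
    using False by (simp add: delta_conv_summand corr_def M.scale_minus_left del: sum.cl_ivl_Suc)
qed

lemma delta_Cons_abs:
  "(\<lambda>As. \<delta> f ((a, b) # As)) =
     (\<lambda>As c. lie a b f As c + corr a b f As c - \<delta> (\<lambda>Xs. f ((a, b) # Xs)) As c)"
  by (intro ext) (rule delta_Cons)

lemma delta_plus: "\<delta> (\<lambda>Xs x. f Xs x + g Xs x) As c = \<delta> f As c + \<delta> g As c"
proof (induction As arbitrary: f g c)
  case Nil
  show ?case by (simp add: delta_Nil)
next
  case (Cons A As)
  then show ?case
    by (cases A) (simp add: delta_Cons lie_add corr_def rho_add)
qed

lemma delta_scale: "\<delta> (\<lambda>Xs x. scaleM r (f Xs x)) As c = scaleM r (\<delta> f As c)"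
proof (induction As arbitrary: f c)
  case Nil
  show ?case by (simp add: delta_Nil)
next
  case (Cons A As)
  then show ?case
    by (cases A) (simp add: delta_Cons lie_scale corr_def rho_scale
        M.scale_right_distrib M.scale_right_diff_distrib)
qed

lemma delta_diff: "\<delta> (\<lambda>Xs x. f Xs x - g Xs x) As c = \<delta> f As c - \<delta> g As c"
  using delta_plus[of f "\<lambda>Xs x. scaleM (- 1) (g Xs x)" As c]
  unfolding delta_scale by (simp add: M.scale_minus_left)

text \<open>At a list of pairs the coboundary reads \<open>f\<close> only at lists shorter by
  one.\<close>

lemma delta_vanish:
  assumes "\<And>Xs x. Suc (length Xs) = length As \<Longrightarrow> f Xs x = 0"
  shows "\<delta> f As c = 0"
  using assms
proof (induction As arbitrary: f c)
  case Nil
  show ?case by (simp add: delta_Nil)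
next
  case (Cons A As)
  then show ?case
    by (cases A) (simp add: delta_Cons lie_def corr_def rho_zero der_vanish)
qed

section \<open>Commutation relations and the square of the coboundary\<close>

lemma corr_Cons: "corr a b f (A # As) c = 0"
  by (simp add: corr_def)

text \<open>Only the empty list contributes. There the second representation axiom moves
  \<open>rho a b\<close> past the \<open>rho\<close> in each of the two summands of
  \<open>corr\<close>.\<close>

lemma lie_corr:
  "lie a b (corr x y f) As c - corr x y (lie a b f) As c =
     corr (bracket a b x) y f As c + corr x (bracket a b y) f As c"
proof (cases As)
  case Nil
  then show ?thesis
    using rho_commute[of a b y c "f [] x"] rho_commute[of a b c x "f [] y"]
    by (simp add: lie_def corr_def rho_add rho_diff)
next
  case (Cons A As')
  have "der (bracket a b) (corr x y f) (A # As') c = 0"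
    by (rule der_vanish) (auto simp: corr_def)
  with Cons show ?thesis
    by (simp add: lie_def corr_Cons rho_zero)
qed

lemma corr_delta: "corr a b (\<delta> f) As c = 0"
  by (simp add: corr_def delta_Nil rho_zero)

text \<open>Since \<open>corr\<close> lives on the empty list, only lists with one pair matter.
  There the coefficients of \<open>f [] a\<close> and of \<open>f [] b\<close> vanish separately,
  each by the first representation axiom.\<close>

lemma delta_corr: "\<delta> (corr a b f) As c = 0"
proof -
  consider "As = []" | x y where "As = [(x, y)]" | "length As \<ge> 2"
  proof (cases As)
    case (Cons A As')
    then show thesis
      using that by (cases A; cases As') auto
  qed (use that in auto)
  then show ?thesis
  proof cases
    case 1
    then show ?thesis by (simp add: delta_Nil)
  next
    case 2
    then show ?thesis
      using rho_bracket[of x y c b "f [] a"] rho_bracket[of x y c a "f [] b"]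
        rho_skew[of b "bracket x y c" "f [] a"]
      by (simp add: delta_Cons delta_Nil lie_def corr_def rho_add
          rho_skew[of b] rho_minus rho_diff)
  next
    case 3
    then show ?thesis
      by (intro delta_vanish) (auto simp: corr_def)
  qed
qed

lemma lie_delta:
  assumes "multilinear f"
  shows "lie a b (\<delta> f) As c = \<delta> (lie a b f) As c"
  using assms
proof (induction As arbitrary: f c)
  case Nil
  show ?case by (simp add: delta_Nil lie_def rho_zero)
next
  case (Cons A As)
  obtain x y where A: "A = (x, y)" by (cases A)
  \<comment> \<open>Expanding at the first pair splits the difference into three defects: those of
    the commutator rules for \<open>lie\<close> and for \<open>corr\<close>, and that of the
    statement itself for the insertion of \<open>A\<close>. The coboundaries of the insertions of
    \<open>A\<close> bracketed with \<open>(a, b)\<close> cancel.\<close>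
  have "lie a b (\<delta> f) (A # As) c - \<delta> (lie a b f) (A # As) c =
      (lie a b (lie x y f) As c - lie x y (lie a b f) As c
        - lie (bracket a b x) y f As c - lie x (bracket a b y) f As c)
      + (lie a b (corr x y f) As c - corr x y (lie a b f) As c
        - corr (bracket a b x) y f As c - corr x (bracket a b y) f As c)
      - (lie a b (\<delta> (\<lambda>Xs. f (A # Xs))) As c - \<delta> (lie a b (\<lambda>Xs. f (A # Xs))) As c)"
    by (simp add: A lie_Cons delta_Cons delta_Cons_abs lie_Cons_abs lie_add lie_diff delta_diff)
  also have "\<dots> = 0"
    using lie_commutator[OF Cons.prems, of a b x y As c] lie_corr[of a b x y f As c]
      Cons.IH[OF multilinear_Cons[OF Cons.prems], of A c]
    by simp
  finally show ?case by simp
qed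

text \<open>Applying the Cartan formula twice yields \<open>lie\<close> after \<delta> minus
  \<delta> after \<open>lie\<close>, which is zero, two \<open>corr\<close> terms that vanish on
  their own, and the double coboundary of the insertion, settled by induction.\<close>

lemma delta_delta:
  assumes "multilinear f"
  shows "\<delta> (\<delta> f) As c = 0"
  using assms
proof (induction As arbitrary: f c)
  case Nil
  show ?case by (simp add: delta_Nil)
next
  case (Cons A As)
  obtain a b where A: "A = (a, b)" by (cases A)
  have "\<delta> (\<delta> f) (A # As) c = \<delta> (\<delta> (\<lambda>Xs. f (A # Xs))) As c"
    by (simp add: A delta_Cons delta_Cons_abs delta_diff delta_plus delta_corr
        lie_delta[OF Cons.prems] corr_delta)
  then show ?case
    by (simp add: Cons.IH[OF multilinear_Cons[OF Cons.prems]])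
qed

section \<open>Commutation of \<open>Phi\<close> with the coboundary\<close>

lemma Phi_conv_der:
  "\<Phi> f As c = der d f As c + scaleM (of_nat (length As) * lam) (f As c) - dM (f As c)"
  unfolding Phi_def Let_def der_conv_sum by simp

lemma Phi_abs:
  "\<Phi> f = (\<lambda>As c. der d f As c + scaleM (of_nat (length As) * lam) (f As c) - dM (f As c))"
  by (intro ext) (rule Phi_conv_der)

lemma Phi_Cons:
  "\<Phi> f ((a, b) # As) c = \<Phi> (\<lambda>Xs. f ((a, b) # Xs)) As c
     + f ((d a, b) # As) c + f ((a, d b) # As) c + scaleM lam (f ((a, b) # As) c)"
  by (simp add: Phi_conv_der M.scale_left_distrib algebra_simps)

lemma Phi_Cons_abs:
  "(\<lambda>As. \<Phi> f ((a, b) # As)) = (\<lambda>As c. \<Phi> (\<lambda>Xs. f ((a, b) # Xs)) As c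
     + f ((d a, b) # As) c + f ((a, d b) # As) c + scaleM lam (f ((a, b) # As) c))"
  by (intro ext) (rule Phi_Cons)

lemma Phi_plus: "\<Phi> (\<lambda>Xs x. f Xs x + g Xs x) As c = \<Phi> f As c + \<Phi> g As c"
  by (simp add: Phi_conv_der der_plus dM_add M.scale_right_distrib)

lemma Phi_scale: "\<Phi> (\<lambda>Xs x. scaleM r (f Xs x)) As c = scaleM r (\<Phi> f As c)"
  by (simp add: Phi_conv_der der_map[of "scaleM r"] M.scale_right_distrib dM_scale
      M.scale_right_diff_distrib mult.commute)

lemma Phi_diff: "\<Phi> (\<lambda>Xs x. f Xs x - g Xs x) As c = \<Phi> f As c - \<Phi> g As c"
  using Phi_plus[of f "\<lambda>Xs x. scaleM (- 1) (g Xs x)" As c]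
  unfolding Phi_scale by (simp add: M.scale_minus_left)

lemma Phi_vanish:
  assumes "\<And>Xs x. length Xs = length As \<Longrightarrow> f Xs x = 0"
  shows "\<Phi> f As c = 0"
  using assms by (simp add: Phi_conv_der der_vanish dM_zero)

text \<open>The derivation rule for \<open>d\<close>, read as a formula for \<open>d\<close> after
  \<open>[a,b,-]\<close>, is pushed through \<open>der\<close>; its \<lambda>-term becomes the
  scalar multiple.\<close>

lemma der_bracket_d:
  assumes "multilinear f"
  shows "der (bracket (d a) b) f As c + der (bracket a (d b)) f As c
       + scaleM lam (der (bracket a b) f As c)
     = der (bracket a b) (der d f) As c - der d (der (bracket a b) f) As c"
proof -
  have "der (\<lambda>x. d (bracket a b x)) f As c =
      der (bracket (d a) b) f As c + der (bracket a (d b)) f As c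
        + der (\<lambda>x. bracket a b (d x)) f As c + scaleM lam (der (bracket a b) f As c)"
    unfolding d_bracket by (simp only: der_add[OF assms] der_scale[OF assms])
  then show ?thesis
    by (simp add: der_commutator)
qed

text \<open>The \<open>rho\<close> part of \<open>lie\<close> against the \<open>dM\<close> part of
  \<open>Phi\<close> gives \<open>dM_rho\<close>, and the two \<open>der\<close> parts give
  \<open>der_bracket_d\<close>. All other parts commute.\<close>

lemma lie_Phi:
  assumes "multilinear f"
  shows "lie a b (\<Phi> f) As c - \<Phi> (lie a b f) As c =
    lie (d a) b f As c + lie a (d b) f As c + scaleM lam (lie a b f As c)"
proof -
  have "der D (\<lambda>Xs x. scaleM (of_nat (length Xs) * lam) (f Xs x)) As c
      = scaleM (of_nat (length As) * lam) (der D f As c)" for D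
    by (rule der_map_length[of "\<lambda>n. scaleM (of_nat n * lam)"]) (rule M.scale_right_distrib)
  then show ?thesis
    using der_bracket_d[OF assms, of a b As c] dM_rho[of a b "f As c"]
    by (simp add: lie_abs Phi_abs der_plus der_minus der_map[of dM] der_map[of "rho _ _"]
        dM_add rho_add rho_diff rho_scale dM_diff M.scale_right_diff_distrib algebra_simps)
qed

text \<open>On the empty list the \<lambda>-term of \<open>Phi\<close> has coefficient zero, so the
  \<lambda> on the right comes from \<open>dM_rho\<close> alone. The terms with \<open>d c\<close>
  cancel against \<open>corr\<close> evaluated at \<open>d c\<close>.\<close>

lemma corr_Phi:
  "corr a b (\<Phi> f) As c - \<Phi> (corr a b f) As c =
     corr (d a) b f As c + corr a (d b) f As c + scaleM lam (corr a b f As c)"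
proof (cases As)
  case Nil
  then show ?thesis
    using dM_rho[of b c "f [] a"] dM_rho[of c a "f [] b"]
    by (simp add: Phi_conv_der corr_def rho_add rho_diff dM_add M.scale_right_distrib)
next
  case (Cons A As')
  have "\<Phi> (corr a b f) (A # As') c = 0"
    by (rule Phi_vanish) (auto simp: corr_def)
  with Cons show ?thesis
    by (simp add: corr_Cons)
qed

lemma Phi_delta:
  assumes "multilinear f"
  shows "\<Phi> (\<delta> f) As c = \<delta> (\<Phi> f) As c"
  using assms
proof (induction As arbitrary: f c)
  case Nil
  show ?case by (simp add: delta_Nil Phi_conv_der dM_zero)
next
  case (Cons A As)
  obtain a b where A: "A = (a, b)" by (cases A)
  \<comment> \<open>After expansion at \<open>A = (a, b)\<close>, the coboundaries of the insertions
    with \<open>d\<close> applied to \<open>a\<close> or \<open>b\<close>, and the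
    \<lambda>-multiple of the coboundary of the insertion of \<open>A\<close>, occur on both sides
    and cancel. Three defects remain: \<open>lie_Phi\<close>, \<open>corr_Phi\<close> and the
    induction hypothesis.\<close>
  have "\<Phi> (\<delta> f) (A # As) c - \<delta> (\<Phi> f) (A # As) c =
      (lie (d a) b f As c + lie a (d b) f As c + scaleM lam (lie a b f As c)
        - (lie a b (\<Phi> f) As c - \<Phi> (lie a b f) As c))
      + (corr (d a) b f As c + corr a (d b) f As c + scaleM lam (corr a b f As c)
        - (corr a b (\<Phi> f) As c - \<Phi> (corr a b f) As c))
      - (\<Phi> (\<delta> (\<lambda>Xs. f (A # Xs))) As c - \<delta> (\<Phi> (\<lambda>Xs. f (A # Xs))) As c)"
    by (simp add: A Phi_Cons delta_Cons delta_Cons_abs Phi_Cons_abs Phi_plus Phi_diff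
        delta_plus delta_scale M.scale_right_distrib M.scale_right_diff_distrib)
  also have "\<dots> = 0"
    unfolding lie_Phi[OF Cons.prems] corr_Phi
    using Cons.IH[OF multilinear_Cons[OF Cons.prems], of A c]
    by simp
  finally show ?case by simp
qed

subsection \<open>Closure of the cochain spaces\<close>

definition skew_cochain :: "('a, 'm) cochain \<Rightarrow> bool" where
  "skew_cochain f \<longleftrightarrow>
     (\<forall>As Bs a b c. f (As @ (b, a) # Bs) c = - f (As @ (a, b) # Bs) c) \<and>
     (\<forall>As a b c. f (As @ [(a, c)]) b = - f (As @ [(a, b)]) c)"

lemma skew_cochainD:
  assumes "skew_cochain f"
  shows "f (As @ (b, a) # Bs) c = - f (As @ (a, b) # Bs) c"
    "f (As @ [(a, c)]) b = - f (As @ [(a, b)]) c"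
    "f ((b, a) # Bs) c = - f ((a, b) # Bs) c"
    "f [(a, c)] b = - f [(a, b)] c"
proof -
  show *: "f (As @ (b, a) # Bs) c = - f (As @ (a, b) # Bs) c"
    "f (As @ [(a, c)]) b = - f (As @ [(a, b)]) c" for As
    using assms unfolding skew_cochain_def by blast+
  show "f ((b, a) # Bs) c = - f ((a, b) # Bs) c" "f [(a, c)] b = - f [(a, b)] c"
    using *[of "[]"] by simp_all
qed

lemma skew_cochain_Cons:
  assumes "skew_cochain f" shows "skew_cochain (\<lambda>Xs. f (A # Xs))"
  unfolding skew_cochain_def append_Cons[symmetric]
  by (intro conjI allI skew_cochainD[OF assms])

lemma multilinear_slot:
  assumes "multilinear f"
  shows "linAM (\<lambda>x. f (As @ (x, b) # Bs) c)" "linAM (\<lambda>x. f (As @ (a, x) # Bs) c)"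
  using assms unfolding multilinear_def by blast+

text \<open>A cochain vanishes outside its degree, so its linearity and skew-symmetry hold trivially
  for all other list lengths and can be stated without the degree.\<close>

lemma cochains_iff:
  assumes "n \<ge> 1"
  shows "f \<in> cochains scaleA scaleM n \<longleftrightarrow>
     multilinear f \<and> skew_cochain f \<and> (\<forall>As c. length As + 1 \<noteq> n \<longrightarrow> f As c = 0)"
    (is "_ \<longleftrightarrow> ?R")
proof
  assume f: "f \<in> cochains scaleA scaleM n"
  then have vanish: "f As c = 0" if "length As + 1 \<noteq> n" for As c
    using that unfolding cochains_def by blast
  have "linAM (f As)" for As
  proof (cases "length As + 1 = n")
    case False
    then have "f As = (\<lambda>c. 0)" using vanish by blast
    then show ?thesis by (simp add: linAM_zero)
  qed (use f in \<open>auto simp: cochains_def\<close>)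
  moreover have "linAM (\<lambda>x. f (As @ (x, b) # Bs) c) \<and> linAM (\<lambda>x. f (As @ (a, x) # Bs) c) \<and>
      f (As @ (b, a) # Bs) c = - f (As @ (a, b) # Bs) c" for As Bs a b c
  proof (cases "length As + length Bs + 2 = n")
    case True
    then show ?thesis using f unfolding cochains_def by blast
  next
    case False
    then have "f (As @ (x, y) # Bs) c = 0" for x y by (intro vanish) simp
    then show ?thesis by (simp add: linAM_zero)
  qed
  moreover have "f (As @ [(a, c)]) b = - f (As @ [(a, b)]) c" for As a b c
  proof (cases "length As + 2 = n")
    case True
    then show ?thesis using f unfolding cochains_def by blast
  next
    case False
    then have "f (As @ [(x, y)]) z = 0" for x y z by (intro vanish) simp
    then show ?thesis by simp
  qed
  ultimately show ?R
    using vanish unfolding multilinear_def skew_cochain_def by blast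
next
  assume ?R
  then show "f \<in> cochains scaleA scaleM n"
    unfolding cochains_def multilinear_def skew_cochain_def by blast
qed

text \<open>Applied to the insertion of a pair with a variable entry, this gives linearity of
  \<open>der D f\<close> in the first pair.\<close>

lemma der_linAM_param:
  assumes "\<And>Xs y. linAM (\<lambda>t. F t Xs y)"
  shows "linAM (\<lambda>t. der D (F t) As c)"
proof -
  have "F (s + t) = (\<lambda>Xs y. F s Xs y + F t Xs y)" "F (scaleA r t) = (\<lambda>Xs y. scaleM r (F t Xs y))" for r s t
    using assms by (auto simp: linAM_iff fun_eq_iff)
  then show ?thesis
    by (simp add: linAM_iff der_plus der_map[of "scaleM _"] M.scale_right_distrib)
qed

lemma delta_linAM_param:
  assumes "\<And>Xs y. linAM (\<lambda>t. F t Xs y)"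
  shows "linAM (\<lambda>t. \<delta> (F t) As c)"
proof -
  have "F (s + t) = (\<lambda>Xs y. F s Xs y + F t Xs y)" "F (scaleA r t) = (\<lambda>Xs y. scaleM r (F t Xs y))" for r s t
    using assms by (auto simp: linAM_iff fun_eq_iff)
  then show ?thesis
    by (simp add: linAM_iff delta_plus delta_scale)
qed

lemma linAM_comp:
  "linAM h \<Longrightarrow> Vector_Spaces.linear scaleA scaleA D \<Longrightarrow> linAM (\<lambda>x. h (D x))"
  by (simp add: linAM_iff Vector_Spaces.linear_iff)

lemma multilinear_der:
  assumes D: "Vector_Spaces.linear scaleA scaleA D" and f: "multilinear f"
  shows "multilinear (der D f)"
proof -
  have "linAM (der D f As)" for As
    using f
  proof (induction As arbitrary: f)
    case Nil
    then show ?case by (simp add: multilinear_linAM linAM_comp[OF _ D])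
  next
    case (Cons A As)
    obtain a b where A: "A = (a, b)" by (cases A)
    have "linAM (\<lambda>c. der D (\<lambda>Xs. f ((a, b) # Xs)) As c + f ((D a, b) # As) c + f ((a, D b) # As) c)"
      by (intro linAM_plus Cons.IH[OF multilinear_Cons[OF Cons.prems]]
          multilinear_linAM(1)[OF Cons.prems])
    then show ?case by (simp add: A)
  qed
  moreover have "linAM (\<lambda>x. der D f (As @ (x, b) # Bs) c) \<and> linAM (\<lambda>x. der D f (As @ (a, x) # Bs) c)"
    for As Bs a b c
    using f
  proof (induction As arbitrary: f)
    case Nil
    then show ?case
      by (auto intro!: linAM_plus der_linAM_param multilinear_linAM(2,3)[OF Nil]
          linAM_comp[OF multilinear_linAM(2)[OF Nil] D] linAM_comp[OF multilinear_linAM(3)[OF Nil] D])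
  next
    case (Cons A As)
    obtain u v where A: "A = (u, v)" by (cases A)
    show ?case
      using Cons.IH[OF multilinear_Cons[OF Cons.prems, of A]]
        multilinear_slot[OF multilinear_Cons[OF Cons.prems]]
      by (auto simp: A intro!: linAM_plus)
  qed
  ultimately show ?thesis
    unfolding multilinear_def by blast
qed

lemma multilinear_lie:
  assumes "multilinear f"
  shows "multilinear (lie a b f)"
proof -
  have D: "multilinear (der (bracket a b) f)"
    using bracket_linear3 assms by (rule multilinear_der)
  show ?thesis
    unfolding multilinear_def lie_abs
    by (intro conjI allI linAM_diff linAM_rho multilinear_slot[OF assms] multilinear_slot[OF D]
        multilinear_linAM(1)[OF assms] multilinear_linAM(1)[OF D])
qed

lemma lie_linAM_param:
  assumes "multilinear f"
  shows "linAM (\<lambda>x. lie x b f As c)" "linAM (\<lambda>x. lie a x f As c)"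
proof -
  have "bracket (x + y) b = (\<lambda>z. bracket x b z + bracket y b z)"
    "bracket a (x + y) = (\<lambda>z. bracket a x z + bracket a y z)"
    "bracket (scaleA r x) b = (\<lambda>z. scaleA r (bracket x b z))"
    "bracket a (scaleA r x) = (\<lambda>z. scaleA r (bracket a x z))" for r x y
    by (auto simp: bracket_add bracket_scale)
  then show "linAM (\<lambda>x. lie x b f As c)" "linAM (\<lambda>x. lie a x f As c)"
    by (simp_all add: linAM_iff lie_def rho_add rho_scale der_add[OF assms] der_scale[OF assms]
        M.scale_right_diff_distrib)
qed

lemma multilinear_delta:
  assumes f: "multilinear f"
  shows "multilinear (\<delta> f)"
proof -
  have "linAM (\<delta> f As)" for As
    using f
  proof (induction As arbitrary: f)
    case Nil
    then show ?case by (simp add: linAM_iff delta_Nil)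
  next
    case (Cons A As)
    obtain a b where A: "A = (a, b)" by (cases A)
    have "linAM (corr a b f As)"
      by (simp add: linAM_iff corr_def rho_add rho_scale M.scale_right_distrib)
    then have "linAM (\<lambda>c. lie a b f As c + corr a b f As c - \<delta> (\<lambda>Xs. f ((a, b) # Xs)) As c)"
      by (intro linAM_plus linAM_diff Cons.IH[OF multilinear_Cons[OF Cons.prems]]
          multilinear_linAM(1)[OF multilinear_lie[OF Cons.prems]])
    then show ?case by (simp add: A delta_Cons[abs_def])
  qed
  moreover have "linAM (\<lambda>x. \<delta> f (As @ (x, b) # Bs) c) \<and> linAM (\<lambda>x. \<delta> f (As @ (a, x) # Bs) c)"
    for As Bs a b c
    using f
  proof (induction As arbitrary: f)
    \<comment> \<open>The variable sits in the first pair, so each of the three terms of the Cartan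
      formula must depend linearly on that pair.\<close>
    case Nil
    have "linAM (\<lambda>x. corr x b f Bs c)" "linAM (\<lambda>x. corr a x f Bs c)"
      by (auto simp: linAM_iff corr_def rho_add rho_scale multilinear_add[OF Nil]
          multilinear_scale[OF Nil] M.scale_right_distrib)
    then show ?case
      by (auto simp: delta_Cons intro!: linAM_plus linAM_diff delta_linAM_param
          multilinear_linAM[OF Nil] lie_linAM_param[OF Nil])
  next
    case (Cons A As)
    obtain u v where A: "A = (u, v)" by (cases A)
    show ?case
      using Cons.IH[OF multilinear_Cons[OF Cons.prems, of A]]
        multilinear_slot[OF multilinear_lie[OF Cons.prems]]
      by (auto simp: A delta_Cons corr_def intro!: linAM_diff)
  qed
  ultimately show ?thesis
    unfolding multilinear_def by blast
qed

lemma multilinear_Phi: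
  assumes "multilinear f"
  shows "multilinear (\<Phi> f)"
proof -
  note D = multilinear_der[OF d_linear assms]
  show ?thesis
    unfolding multilinear_def Phi_abs length_append list.size
    by (intro conjI allI linAM_plus linAM_diff linAM_scale linAM_dM multilinear_slot[OF assms]
        multilinear_slot[OF D] multilinear_linAM(1)[OF assms] multilinear_linAM(1)[OF D])
qed

text \<open>Exchanging two vectors permutes the Leibniz terms, and each changes sign by the
  skew-symmetry of \<open>f\<close>.\<close>

lemma skew_cochain_der:
  assumes "skew_cochain f"
  shows "skew_cochain (der D f)"
proof -
  have "der D f (As @ (b, a) # Bs) c = - der D f (As @ (a, b) # Bs) c" for As Bs a b c
    using assms
  proof (induction As arbitrary: f)
    case Nil
    have "(\<lambda>Xs. f ((b, a) # Xs)) = (\<lambda>Xs x. - f ((a, b) # Xs) x)"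
      by (intro ext skew_cochainD(3)[OF Nil])
    then show ?case
      using skew_cochainD(3)[OF Nil, of "D b" a] skew_cochainD(3)[OF Nil, of b "D a"]
      by (simp add: der_uminus)
  next
    case (Cons A As)
    then show ?case
      using Cons.IH[OF skew_cochain_Cons[OF Cons.prems, of A]]
        skew_cochainD(1)[OF skew_cochain_Cons[OF Cons.prems], of _ As b a]
      by (cases A) simp
  qed
  moreover have "der D f (As @ [(a, c)]) b = - der D f (As @ [(a, b)]) c" for As a b c
    using assms
  proof (induction As arbitrary: f)
    case Nil
    show ?case
      using skew_cochainD(4)[OF Nil, of "D a" c b] skew_cochainD(4)[OF Nil, of a "D c" b]
        skew_cochainD(4)[OF Nil, of a c "D b"]
      by simp
  next
    case (Cons A As)
    then show ?case
      using Cons.IH[OF skew_cochain_Cons[OF Cons.prems, of A]]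
        skew_cochainD(2)[OF skew_cochain_Cons[OF Cons.prems], of _ As a c b]
      by (cases A) simp
  qed
  ultimately show ?thesis
    unfolding skew_cochain_def by blast
qed

lemma skew_cochain_lie:
  assumes "skew_cochain f"
  shows "skew_cochain (lie a b f)"
proof -
  note D = skew_cochain_der[OF assms, of "bracket a b"]
  have "lie a b f (As @ (y, x) # Bs) c = - lie a b f (As @ (x, y) # Bs) c" for As Bs x y c
    by (simp add: lie_def skew_cochainD(1)[OF assms, of As y x] skew_cochainD(1)[OF D, of As y x]
        rho_minus)
  moreover have "lie a b f (As @ [(x, z)]) y = - lie a b f (As @ [(x, y)]) z" for As x y z
    by (simp add: lie_def skew_cochainD(2)[OF assms, of As x z y] skew_cochainD(2)[OF D, of As x z y]
        rho_minus)
  ultimately show ?thesis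
    unfolding skew_cochain_def by blast
qed

lemma skew_cochain_delta:
  assumes f: "multilinear f" "skew_cochain f"
  shows "skew_cochain (\<delta> f)"
proof -
  have "\<delta> f (As @ (b, a) # Bs) c = - \<delta> f (As @ (a, b) # Bs) c" for As Bs a b c
    using f
  proof (induction As arbitrary: f)
    case Nil
    \<comment> \<open>Writing the sign as a scalar lets \<open>delta_scale\<close> carry it through
      the coboundary.\<close>
    have "(\<lambda>Xs. f ((b, a) # Xs)) = (\<lambda>Xs x. scaleM (- 1) (f ((a, b) # Xs) x))"
      by (intro ext) (simp add: skew_cochainD(3)[OF Nil(2), of b a] M.scale_minus_left)
    moreover have "lie b a f Bs c = - lie a b f Bs c"
    proof -
      have "bracket b a = (\<lambda>x. scaleA (- 1) (bracket a b x))"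
        by (intro ext) (simp add: bracket_skew12[of b a] scale_minus_left)
      then have "der (bracket b a) f Bs c = - der (bracket a b) f Bs c"
        by (simp only: der_scale[OF Nil(1)] M.scale_minus_left M.scale_one)
      then show ?thesis
        by (simp add: lie_def rho_skew[of b a])
    qed
    moreover have "corr b a f Bs c = - corr a b f Bs c"
      by (simp add: corr_def rho_skew[of a c] rho_skew[of c b])
    ultimately show ?case
      using delta_scale[of "- 1" "\<lambda>Xs. f ((a, b) # Xs)" Bs c]
      by (simp add: delta_Cons M.scale_minus_left)
  next
    case (Cons A As)
    then show ?case
      using Cons.IH[OF multilinear_Cons[OF Cons.prems(1), of A] skew_cochain_Cons[OF Cons.prems(2), of A]]
        skew_cochainD(1)[OF skew_cochain_lie[OF Cons.prems(2)], of _ _ As b a]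
      by (cases A) (simp add: delta_Cons corr_def)
  qed
  moreover have "\<delta> f (As @ [(a, c)]) b = - \<delta> f (As @ [(a, b)]) c" for As a b c
    using f
  proof (induction As arbitrary: f)
    \<comment> \<open>On one pair the coboundary is \<open>rho a b (f [] c) + rho b c (f [] a) + rho
      c a (f [] b) - f [] (bracket a b c)\<close>, which changes sign when \<open>b\<close> and
      \<open>c\<close> are exchanged.\<close>
    case Nil
    have "f [] (bracket a c b) = - f [] (bracket a b c)"
      using multilinear_scale(1)[OF Nil(1), of "[]" "- 1" "bracket a b c"]
      by (simp add: bracket_skew23[of a c b] scale_minus_left M.scale_minus_left)
    then show ?case
      by (simp add: delta_Cons delta_Nil lie_def corr_def rho_skew[of c b] rho_skew[of b a]
          rho_skew[of c a])
  next
    case (Cons A As)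
    then show ?case
      using Cons.IH[OF multilinear_Cons[OF Cons.prems(1), of A] skew_cochain_Cons[OF Cons.prems(2), of A]]
        skew_cochainD(2)[OF skew_cochain_lie[OF Cons.prems(2)], of _ _ As a c b]
      by (cases A) (simp add: delta_Cons corr_def)
  qed
  ultimately show ?thesis
    unfolding skew_cochain_def by blast
qed

lemma skew_cochain_Phi:
  assumes "skew_cochain f"
  shows "skew_cochain (\<Phi> f)"
proof -
  note D = skew_cochain_der[OF assms, of d]
  have "\<Phi> f (As @ (b, a) # Bs) c = - \<Phi> f (As @ (a, b) # Bs) c" for As Bs a b c
    by (simp add: Phi_conv_der skew_cochainD(1)[OF assms, of As b a] skew_cochainD(1)[OF D, of As b a]
        dM_minus M.scale_minus_right)
  moreover have "\<Phi> f (As @ [(a, c)]) b = - \<Phi> f (As @ [(a, b)]) c" for As a b c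
    by (simp add: Phi_conv_der skew_cochainD(2)[OF assms, of As a c b] skew_cochainD(2)[OF D, of As a c b]
        dM_minus M.scale_minus_right)
  ultimately show ?thesis
    unfolding skew_cochain_def by blast
qed

lemma delta_cochains:
  assumes "n \<ge> 1" "f \<in> cochains scaleA scaleM n"
  shows "\<delta> f \<in> cochains scaleA scaleM (n + 1)"
  using assms by (auto simp: cochains_iff multilinear_delta skew_cochain_delta intro!: delta_vanish)

lemma Phi_cochains:
  assumes "n \<ge> 1" "f \<in> cochains scaleA scaleM n"
  shows "\<Phi> f \<in> cochains scaleA scaleM n"
  using assms by (auto simp: cochains_iff multilinear_Phi skew_cochain_Phi intro!: Phi_vanish)

lemma cochains_add:
  assumes n: "n \<ge> 1" and f: "f \<in> cochains scaleA scaleM n" and g: "g \<in> cochains scaleA scaleM n"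
  shows "f + g \<in> cochains scaleA scaleM n"
proof -
  have eq: "f + g = (\<lambda>As c. f As c + g As c)"
    by (intro ext) simp
  have *: "multilinear f" "skew_cochain f" "multilinear g" "skew_cochain g"
    using n f g by (simp_all add: cochains_iff)
  have "multilinear (f + g)"
    unfolding multilinear_def eq
    by (intro conjI allI linAM_plus multilinear_slot multilinear_linAM(1) *)
  moreover have "skew_cochain (f + g)"
    unfolding skew_cochain_def eq minus_add_distrib
    by (intro conjI allI arg_cong2[where f = "(+)"] skew_cochainD *)
  ultimately show ?thesis
    using n f g by (simp add: cochains_iff)
qed

lemma cochains_scale:
  assumes n: "n \<ge> 1" and f: "f \<in> cochains scaleA scaleM n"
  shows "cochain_scale scaleM r f \<in> cochains scaleA scaleM n"
proof -
  have *: "multilinear f" "skew_cochain f"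
    using n f by (simp_all add: cochains_iff)
  have "multilinear (cochain_scale scaleM r f)"
    unfolding multilinear_def cochain_scale_def
    by (intro conjI allI linAM_scale multilinear_slot multilinear_linAM(1) *)
  moreover have "skew_cochain (cochain_scale scaleM r f)"
    unfolding skew_cochain_def cochain_scale_def M.scale_minus_right[symmetric]
    by (intro conjI allI arg_cong[where f = "scaleM r"] skew_cochainD *)
  ultimately show ?thesis
    using n f by (simp add: cochains_iff cochain_scale_def)
qed

section \<open>The mapping cone of \<open>Phi\<close>\<close>

lemma delta_fun_add: "\<delta> (f + g) = \<delta> f + \<delta> g"
proof (intro ext)
  have "f + g = (\<lambda>As c. f As c + g As c)"
    by (intro ext) simp
  then show "\<delta> (f + g) As c = (\<delta> f + \<delta> g) As c" for As c
    by (simp add: delta_plus)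
qed

lemma Phi_fun_add: "\<Phi> (f + g) = \<Phi> f + \<Phi> g"
proof (intro ext)
  have "f + g = (\<lambda>As c. f As c + g As c)"
    by (intro ext) simp
  then show "\<Phi> (f + g) As c = (\<Phi> f + \<Phi> g) As c" for As c
    by (simp add: Phi_plus)
qed

lemma delta_fun_scale: "\<delta> (cochain_scale scaleM r f) = cochain_scale scaleM r (\<delta> f)"
  by (intro ext) (simp add: cochain_scale_def delta_scale)

lemma Phi_fun_scale: "\<Phi> (cochain_scale scaleM r f) = cochain_scale scaleM r (\<Phi> f)"
  by (intro ext) (simp add: cochain_scale_def Phi_scale)

lemma cochain_scale_add:
  "cochain_scale scaleM r (f + g) = cochain_scale scaleM r f + cochain_scale scaleM r g"
  by (intro ext) (simp add: cochain_scale_def M.scale_right_distrib)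

lemma cochain_scale_commute:
  "cochain_scale scaleM r (cochain_scale scaleM s f) = cochain_scale scaleM s (cochain_scale scaleM r f)"
  by (intro ext) (simp add: cochain_scale_def mult.commute)

text \<open>Puts the sign in degree one into the form \<open>(-1) ^ n\<close> used in higher
  degrees.\<close>

lemma uminus_conv_cochain_scale: "- f = cochain_scale scaleM (- 1) f"
  by (intro ext) (simp add: cochain_scale_def M.scale_minus_left)

lemma linear_md_coboundary1:
  "linear_map_between (cochain_scale scaleM) (md_cochain_scale scaleM)
     (cochains scaleA scaleM 1) (md_cochains scaleA scaleM 2)
     (md_coboundary1 bracket d lam scaleM rho dM)"
  unfolding linear_map_between_def md_coboundary1_def md_cochains_def md_cochain_scale_def
    uminus_conv_cochain_scale
  using delta_cochains[of 1] cochains_scale[of 1] Phi_cochains[of 1]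
  by (auto simp: delta_fun_add Phi_fun_add delta_fun_scale Phi_fun_scale cochain_scale_add
      numeral_2_eq_2 intro: cochain_scale_commute)

lemma linear_md_coboundary:
  assumes "n \<ge> 2"
  shows "linear_map_between (md_cochain_scale scaleM) (md_cochain_scale scaleM)
     (md_cochains scaleA scaleM n) (md_cochains scaleA scaleM (n + 1))
     (md_coboundary bracket d lam scaleM rho dM n)"
  using assms delta_cochains[of n] delta_cochains[of "n - 1"] cochains_scale[of n]
    Phi_cochains[of n] cochains_add[of n]
  unfolding linear_map_between_def md_coboundary_def md_cochains_def md_cochain_scale_def
  by (auto simp: delta_fun_add Phi_fun_add delta_fun_scale Phi_fun_scale cochain_scale_add
      algebra_simps intro: cochain_scale_commute)

lemma md_coboundary1_zero:
  assumes "f \<in> cochains scaleA scaleM 1"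
  shows "md_coboundary bracket d lam scaleM rho dM 2
     (md_coboundary1 bracket d lam scaleM rho dM f) = 0"
proof -
  have f: "multilinear f"
    using assms by (simp add: cochains_iff)
  show ?thesis
    unfolding md_coboundary1_def md_coboundary_def uminus_conv_cochain_scale prod.case delta_fun_scale
    by (auto simp: zero_prod_def fun_eq_iff cochain_scale_def delta_delta[OF f]
        Phi_delta[OF f] M.scale_minus_left)
qed

text \<open>In the second component the double coboundary of \<open>g\<close> vanishes, and the two
  mixed terms carry the signs \<open>(-1) ^ n\<close> and \<open>(-1) ^ (n + 1)\<close>, so they
  cancel by \<open>Phi_delta\<close>.\<close>

lemma md_coboundary_zero:
  assumes "n \<ge> 2" "x \<in> md_cochains scaleA scaleM n"
  shows "md_coboundary bracket d lam scaleM rho dM (n + 1)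
     (md_coboundary bracket d lam scaleM rho dM n x) = 0"
proof -
  obtain f g where x: "x = (f, g)" and f: "multilinear f" and g: "multilinear g"
    using assms by (cases x) (auto simp: md_cochains_def cochains_iff)
  show ?thesis
    unfolding md_coboundary_def x prod.case delta_fun_add delta_fun_scale
    by (auto simp: zero_prod_def fun_eq_iff cochain_scale_def
        delta_delta[OF f] delta_delta[OF g] Phi_delta[OF f] M.scale_minus_left)
qed

end

theorem theorem2p17:
  fixes scaleA :: "'k::field_char_0 \<Rightarrow> 'a::ab_group_add \<Rightarrow> 'a"
    and bracket :: "'a \<Rightarrow> 'a \<Rightarrow> 'a \<Rightarrow> 'a"
    and d :: "'a \<Rightarrow> 'a"
    and lam :: 'k
    and scaleM :: "'k \<Rightarrow> 'm::ab_group_add \<Rightarrow> 'm"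
    and rho :: "'a \<Rightarrow> 'a \<Rightarrow> 'm \<Rightarrow> 'm"
    and dM :: "'m \<Rightarrow> 'm"
  assumes "md_representation scaleA bracket d lam scaleM rho dM"
  shows "(linear_map_between (cochain_scale scaleM) (md_cochain_scale scaleM)
           (cochains scaleA scaleM 1) (md_cochains scaleA scaleM 2)
           (md_coboundary1 bracket d lam scaleM rho dM))
       \<and> (\<forall>n\<ge>2. linear_map_between (md_cochain_scale scaleM) (md_cochain_scale scaleM)
           (md_cochains scaleA scaleM n) (md_cochains scaleA scaleM (n + 1))
           (md_coboundary bracket d lam scaleM rho dM n))
       \<and> (\<forall>f \<in> cochains scaleA scaleM 1.
           md_coboundary bracket d lam scaleM rho dM 2
             (md_coboundary1 bracket d lam scaleM rho dM f) = 0)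
       \<and> (\<forall>n\<ge>2. \<forall>x \<in> md_cochains scaleA scaleM n.
           md_coboundary bracket d lam scaleM rho dM (n + 1)
             (md_coboundary bracket d lam scaleM rho dM n x) = 0)"
proof -
  interpret md_representation scaleA bracket d lam scaleM rho dM
    by (fact assms)
  show ?thesis
    using linear_md_coboundary1 linear_md_coboundary md_coboundary1_zero md_coboundary_zero
    by blast
qed

end
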